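(* Let $b:\mathbb{R}^{n}\to\mathbb{R}$ be an Auxiliary-Variable Adaptive Control Barrier Function (AVCBF) with relative degree $m$ for the system $\dot{\boldsymbol{x}}=f(\boldsymbol{x})+g(\boldsymbol{x})\boldsymbol{u}$, $\boldsymbol{u}\in\mathcal{U}$, with auxiliary variables satisfying $a_i(t)>0$ for all $t\ge 0$, $i\in\{1,\dots,m\}$, and with the corresponding functions $\psi_0,\dots,\psi_m$ and sets $\mathcal{C}_0,\dots,\mathcal{C}_{m-1}$ (all defined in the context). Suppose $(\boldsymbol{x}(0),\boldsymbol{\Pi}(0))\in\mathcal{C}_0\cap\dots\cap\mathcal{C}_{m-1}$. If there exists a Lipschitz controller $(\boldsymbol{u},\boldsymbol{\nu})$, with $\boldsymbol{u}\in\mathcal{U}$ and $\boldsymbol{\nu}\in\mathcal{U}_{\boldsymbol{a}}(\boldsymbol{\Pi})$, which satisfies the AVCBF constraint $$\psi_m(\boldsymbol{x},\boldsymbol{\Pi},\boldsymbol{u},\boldsymbol{\nu})\ge 0$$ for all $t\ge 0$ and which also ensures $(\boldsymbol{x}(t),\boldsymbol{\Pi}(t))\in\mathcal{C}_{m-1}$ for all $t\ge 0$, then under this controller $\mathcal{C}_0\cap\dots\cap\mathcal{C}_{m-1}$ is rendered forward invariant, i.e., $$(\boldsymbol{x}(t),\boldsymbol{\Pi}(t))\in\mathcal{C}_0\cap\dots\cap\mathcal{C}_{m-1}\quad\text{for all } t\ge 0.$$ Moreover, $b(\boldsymbol{x}(t))\ge 0$ for all $t\ge 0$.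
   Context: **System.** $\boldsymbol{x}\in\mathbb{R}^n$; $f:\mathbb{R}^n\to\mathbb{R}^n$ and $g:\mathbb{R}^n\to\mathbb{R}^{n\times q}$ are locally Lipschitz (and as smooth as needed for the Lie derivatives below to exist); $\mathcal{U}=\{\boldsymbol{u}\in\mathbb{R}^q:\boldsymbol{u}_{min}\le\boldsymbol{u}\le\boldsymbol{u}_{max}\}$ componentwise. The dynamics are $\dot{\boldsymbol{x}}=f(\boldsymbol{x})+g(\boldsymbol{x})\boldsymbol{u}$. The relative degree of a (sufficiently differentiable) function $b:\mathbb{R}^n\to\mathbb{R}$ is the minimum number of times one needs to differentiate it along the dynamics until every component of $\boldsymbol{u}$ explicitly shows; $b$ has relative degree $m\ge1$. $L_f$ denotes the Lie derivative along $f$ and $L_g$ the row of Lie derivatives along the columns of $g$. **Class $\kappa$ functions.** A class $\kappa$ function $\alpha$ is a continuous, strictly increasing function with $\alpha(0)=0$; it is taken to be defined on $\mathbb{R}$, since below it is evaluated at arbitrary real values. **Auxiliary systems.** For each $i\in\{1,\dots,m\}$ there is an auxiliary state $\boldsymbol{\pi}_i(t)=[\pi_{i,1}(t),\dots,\pi_{i,m+1-i}(t)]^T\in\mathbb{R}^{m+1-i}$ and a scalar auxiliary input $\nu_i\in\mathbb{R}$, governed by the integrator chain $$\dot\pi_{i,1}=\pi_{i,2},\ \dots,\ \dot\pi_{i,m-i}=\pi_{i,m+1-i},\ \dot\pi_{i,m+1-i}=\nu_i,$$ and the auxiliary variable is $a_i(t):=\pi_{i,1}(t)$ (so $a_i^{(m+1-i)}=\nu_i$).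 Write $\boldsymbol{\Pi}(t)=(\boldsymbol{\pi}_1(t),\dots,\boldsymbol{\pi}_m(t))$ and $\boldsymbol{\nu}=[\nu_1,\dots,\nu_m]^T$. Time derivatives $\dot{(\cdot)}$ of functions of $(\boldsymbol{x},\boldsymbol{\Pi})$ below are taken along the dynamics of $\boldsymbol{x}$ and these auxiliary systems. The auxiliary variables are assumed positive: $a_i(t)>0$ for all $t\ge 0$ and all $i$. **HOCBF condition for $a_i$.** Let $\varphi_{i,0}(\boldsymbol{\pi}_i)=a_i=\pi_{i,1}$ and $\varphi_{i,j}=\dot\varphi_{i,j-1}+\alpha_{i,j}(\varphi_{i,j-1})$ for $j\in\{1,\dots,m+1-i\}$, where each $\alpha_{i,j}$ is an $(m+1-i-j)$-th order differentiable class $\kappa$ function. For $j\le m-i$, $\varphi_{i,j}$ is a function of $\boldsymbol{\pi}_i$; $\varphi_{i,m+1-i}$ is a function of $(\boldsymbol{\pi}_i,\nu_i)$, affine in $\nu_i$. Let $\mathcal{B}_{i,j}=\{\boldsymbol{\pi}_i\in\mathbb{R}^{m+1-i}:\varphi_{i,j}(\boldsymbol{\pi}_i)>0\}$, $j\in\{0,\dots,m-i\}$, and let $\epsilon>0$ be a fixed (arbitrarily small) constant. One says $a_i$ is a HOCBF with relative degree $m+1-i$ for its auxiliary system if such $\alpha_{i,j}$ exist with $\sup_{\nu_i\in\mathbb{R}}\varphi_{i,m+1-i}(\boldsymbol{\pi}_i,\nu_i)\ge\epsilon$ for all $\boldsymbol{\pi}_i\in\mathcal{B}_{i,0}\cap\dots\cap\mathcal{B}_{i,m-i}$.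 The constraint set for $\boldsymbol{\nu}$ is $$\mathcal{U}_{\boldsymbol{a}}(\boldsymbol{\Pi})=\{\boldsymbol{\nu}\in\mathbb{R}^m:\varphi_{i,m+1-i}(\boldsymbol{\pi}_i,\nu_i)\ge\epsilon,\ i\in\{1,\dots,m\}\}.$$ **The functions $\psi_i$ and sets $\mathcal{C}_i$.** Given class $\kappa$ functions $\alpha_1,\dots,\alpha_m$, with $\alpha_j$ being $(m-j)$-th order differentiable for $j\le m-1$, define $$\psi_0(\boldsymbol{x},\boldsymbol{\Pi})=a_1\,b(\boldsymbol{x}),\qquad \psi_i(\boldsymbol{x},\boldsymbol{\Pi})=a_{i+1}\big(\dot\psi_{i-1}+\alpha_i(\psi_{i-1})\big),\ i\in\{1,\dots,m-1\},$$ $$\psi_m=\dot\psi_{m-1}+\alpha_m(\psi_{m-1}).$$ For $i\le m-1$, $\psi_i$ is a function of $(\boldsymbol{x},\boldsymbol{\Pi})$; $\psi_m$ is a function of $(\boldsymbol{x},\boldsymbol{\Pi},\boldsymbol{u},\boldsymbol{\nu})$, affine in $(\boldsymbol{u},\boldsymbol{\nu})$. Explicitly (for $m\ge2$), $$\psi_m=\sum_{j=2}^{m-1}\Big(\prod_{k=j+1}^{m}a_k\Big)\frac{\psi_{j-1}}{a_j}\nu_j+\frac{\psi_{m-1}}{a_m}\nu_m+\Big(\prod_{i=2}^{m}a_i\Big)b(\boldsymbol{x})\nu_1+\Big(\prod_{i=1}^{m}a_i\Big)\big(L_f^m b(\boldsymbol{x})+L_gL_f^{m-1}b(\boldsymbol{x})\boldsymbol{u}\big)+R(b(\boldsymbol{x}),\boldsymbol{\Pi})+\alpha_m(\psi_{m-1}),$$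 where $R(b(\boldsymbol{x}),\boldsymbol{\Pi})$ collects the remaining terms, which involve only lower-order derivatives of $b$ and of the $a_i$ and do not depend on $\boldsymbol{u},\boldsymbol{\nu}$. Define $$\mathcal{C}_i=\{(\boldsymbol{x},\boldsymbol{\Pi}):\psi_i(\boldsymbol{x},\boldsymbol{\Pi})\ge 0\},\quad i\in\{0,\dots,m-1\}.$$ **AVCBF.** $b$ is an AVCBF with relative degree $m$ for the system if every $a_i$, $i\in\{1,\dots,m\}$, is a HOCBF with relative degree $m+1-i$ for its auxiliary system, and there exist $(m-j)$-th order differentiable class $\kappa$ functions $\alpha_j$, $j\in\{1,\dots,m-1\}$, and a class $\kappa$ function $\alpha_m$ such that $$\sup_{\boldsymbol{u}\in\mathcal{U},\ \boldsymbol{\nu}\in\mathcal{U}_{\boldsymbol{a}}(\boldsymbol{\Pi})}\psi_m(\boldsymbol{x},\boldsymbol{\Pi},\boldsymbol{u},\boldsymbol{\nu})\ge 0$$ for all $(\boldsymbol{x},\boldsymbol{\Pi})\in\mathcal{C}_0\cap\dots\cap\mathcal{C}_{m-1}$ with each $a_i>0$. The functions $\alpha_j$, $\alpha_{i,j}$ in the claim are the ones realizing this definition. A controller "satisfies the AVCBF constraint" if $\psi_m\ge0$ holds along the resulting trajectory $(\boldsymbol{x}(t),\boldsymbol{\Pi}(t))$, which is assumed to exist for all $t\ge0$. *)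

theory Defs
  imports "HOL-Analysis.Analysis"
begin

section \<open>Regularity and class kappa functions\<close>

text \<open>Local Lipschitz continuity, with the time set of the library notion taken to be a point.\<close>

abbreviation loc_lipschitz :: "'a::metric_space set \<Rightarrow> ('a \<Rightarrow> 'b::metric_space) \<Rightarrow> bool" where
  "loc_lipschitz S h \<equiv> local_lipschitz {0::real} S (\<lambda>_. h)"

text \<open>All derivatives of order 1 to k exist everywhere; the k-th one need not be continuous.\<close>

definition times_differentiable :: "nat \<Rightarrow> (real \<Rightarrow> real) \<Rightarrow> bool" where
  "times_differentiable k h \<longleftrightarrow> (\<forall>l<k. \<forall>y. (deriv ^^ l) h differentiable (at y))"

definition class_kappa :: "(real \<Rightarrow> real) \<Rightarrow> bool" where
  "class_kappa \<alpha> \<longleftrightarrow> continuous_on UNIV \<alpha> \<and> strict_mono \<alpha> \<and> \<alpha> 0 = 0"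


section \<open>Lie derivatives and relative degree\<close>

definition lie :: "(real^'n \<Rightarrow> real^'n) \<Rightarrow> (real^'n \<Rightarrow> real) \<Rightarrow> real^'n \<Rightarrow> real" where
  "lie X h x = frechet_derivative h (at x) (X x)"

text \<open>
  While no input has appeared, the k-th derivative of b along the dynamics is the k-th Lie
  derivative along f, and the component u_j of the input shows explicitly in the next derivative
  iff the Lie derivative along the j-th column of g is not the zero function. No component may
  show before order m, and every component shows at order m.
\<close>

definition relative_degree ::
  "(real^'n \<Rightarrow> real^'n) \<Rightarrow> (real^'n \<Rightarrow> real^'q^'n) \<Rightarrow> nat \<Rightarrow> (real^'n \<Rightarrow> real) \<Rightarrow> bool" where
  "relative_degree f g m b \<longleftrightarrow>
     1 \<le> m \<and>
     (\<forall>k<m. \<forall>x. (lie f ^^ k) b differentiable (at x)) \<and>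
     (\<forall>k<m-1. \<forall>j x. lie (\<lambda>y. column j (g y)) ((lie f ^^ k) b) x = 0) \<and>
     (\<forall>j. \<exists>x. lie (\<lambda>y. column j (g y)) ((lie f ^^ (m-1)) b) x \<noteq> 0)"


section \<open>Auxiliary systems\<close>

text \<open>
  A vector of R^d is a function on nat of which only the entries 1, ..., d matter. The family of
  all auxiliary states is a function P of type nat => nat => real: its entry P i j, with
  i in {1..m} and j in {1..m+1-i}, is the j-th component of the i-th auxiliary state, and P i 1
  is the auxiliary variable a_i. Likewise the auxiliary inputs are the entries 1, ..., m of a
  function nat => real.
\<close>

text \<open>Right-hand side of the integrator chain of length d with state p and input v.\<close>

definition chain :: "nat \<Rightarrow> (nat \<Rightarrow> real) \<Rightarrow> real \<Rightarrow> nat \<Rightarrow> real" where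
  "chain d p v j = (if 1 \<le> j \<and> j < d then p (Suc j) else if j = d then v else 0)"

text \<open>
  Time derivative of h along the chain: the derivative of h in the direction of the vector field.
\<close>

definition chain_deriv ::
  "nat \<Rightarrow> ((nat \<Rightarrow> real) \<Rightarrow> real) \<Rightarrow> (nat \<Rightarrow> real) \<Rightarrow> real \<Rightarrow> real" where
  "chain_deriv d h p v = deriv (\<lambda>s. h (\<lambda>j. p j + s * chain d p v j)) 0"

text \<open>
  Here d is the length m+1-i of the i-th chain and A j stands for alpha_(i,j). For j < d the value
  of phi d A j p v does not depend on the input v, and the function of the state alone is obtained
  by setting v = 0; the input enters only for j = d.
\<close>

primrec phi :: "nat \<Rightarrow> (nat \<Rightarrow> real \<Rightarrow> real) \<Rightarrow> nat \<Rightarrow> (nat \<Rightarrow> real) \<Rightarrow> real \<Rightarrow> real" where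
  "phi d A 0 p v = p 1"
| "phi d A (Suc j) p v =
     chain_deriv d (\<lambda>p'. phi d A j p' 0) p v + A (Suc j) (phi d A j p 0)"

definition B_set :: "nat \<Rightarrow> (nat \<Rightarrow> real \<Rightarrow> real) \<Rightarrow> nat \<Rightarrow> (nat \<Rightarrow> real) set" where
  "B_set d A j = {p. phi d A j p 0 > 0}"

text \<open>
  The auxiliary variable of a chain of length d is a HOCBF, realized by the functions A j.
  The supremum may be infinite, so it is taken in the extended reals.
\<close>

definition hocbf_with :: "real \<Rightarrow> nat \<Rightarrow> (nat \<Rightarrow> real \<Rightarrow> real) \<Rightarrow> bool" where
  "hocbf_with \<epsilon> d A \<longleftrightarrow>
     (\<forall>j\<in>{1..d}. class_kappa (A j) \<and> times_differentiable (d - j) (A j)) \<and>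
     (\<forall>p\<in>(\<Inter>j<d. B_set d A j). (SUP v. ereal (phi d A d p v)) \<ge> ereal \<epsilon>)"

definition U_a ::
  "nat \<Rightarrow> real \<Rightarrow> (nat \<Rightarrow> nat \<Rightarrow> real \<Rightarrow> real) \<Rightarrow> (nat \<Rightarrow> nat \<Rightarrow> real) \<Rightarrow> (nat \<Rightarrow> real) set" where
  "U_a m \<epsilon> A P = {\<nu>. \<forall>i\<in>{1..m}. phi (m+1-i) (A i) (m+1-i) (P i) (\<nu> i) \<ge> \<epsilon>}"


section \<open>Auxiliary-variable adaptive control barrier functions\<close>

type_synonym 'n state = "(real^'n) \<times> (nat \<Rightarrow> nat \<Rightarrow> real)"

text \<open>
  Time derivative of a function h of the state (x, P) along the dynamics of x and of all the
  auxiliary systems, again as the derivative of h in the direction of the vector field.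
\<close>

definition time_deriv ::
  "(real^'n \<Rightarrow> real^'n) \<Rightarrow> (real^'n \<Rightarrow> real^'q^'n) \<Rightarrow> nat \<Rightarrow> ('n state \<Rightarrow> real) \<Rightarrow>
   'n state \<Rightarrow> real^'q \<Rightarrow> (nat \<Rightarrow> real) \<Rightarrow> real" where
  "time_deriv f g m h = (\<lambda>(x, P) u \<nu>.
     deriv (\<lambda>s. h (x + s *\<^sub>R (f x + g x *v u),
                   \<lambda>i j. P i j + s * chain (m+1-i) (P i) (\<nu> i) j)) 0)"

text \<open>
  If b has relative degree m, then for i < m the value of psi f g m b \<alpha> i z u \<nu> does not depend on
  the inputs u and \<nu>, and the function of the state alone is obtained by setting both to 0; the
  inputs enter only for i = m. The factor a_(i+1) is present for 1 \<le> i < m and absent for i = m.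
\<close>

primrec psi ::
  "(real^'n \<Rightarrow> real^'n) \<Rightarrow> (real^'n \<Rightarrow> real^'q^'n) \<Rightarrow> nat \<Rightarrow> (real^'n \<Rightarrow> real) \<Rightarrow> (nat \<Rightarrow> real \<Rightarrow> real) \<Rightarrow>
   nat \<Rightarrow> 'n state \<Rightarrow> real^'q \<Rightarrow> (nat \<Rightarrow> real) \<Rightarrow> real" where
  "psi f g m b \<alpha> 0 z u \<nu> = snd z 1 1 * b (fst z)"
| "psi f g m b \<alpha> (Suc i) z u \<nu> =
     (if Suc i < m then snd z (Suc (Suc i)) 1 else 1) *
     (time_deriv f g m (\<lambda>z'. psi f g m b \<alpha> i z' 0 (\<lambda>_. 0)) z u \<nu> +
      \<alpha> (Suc i) (psi f g m b \<alpha> i z 0 (\<lambda>_. 0)))"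

definition C_set ::
  "(real^'n \<Rightarrow> real^'n) \<Rightarrow> (real^'n \<Rightarrow> real^'q^'n) \<Rightarrow> nat \<Rightarrow> (real^'n \<Rightarrow> real) \<Rightarrow> (nat \<Rightarrow> real \<Rightarrow> real) \<Rightarrow>
   nat \<Rightarrow> 'n state set" where
  "C_set f g m b \<alpha> i = {z. psi f g m b \<alpha> i z 0 (\<lambda>_. 0) \<ge> 0}"

text \<open>
  b is an AVCBF with relative degree m, realized by the functions A i j for the auxiliary
  variables and \<alpha> j for b. The differentiability requirement is void for j = m. The supremum is
  taken in the extended reals, where the supremum over an empty set is minus infinity.
\<close>

definition avcbf_with ::
  "(real^'n \<Rightarrow> real^'n) \<Rightarrow> (real^'n \<Rightarrow> real^'q^'n) \<Rightarrow> (real^'q) set \<Rightarrow> nat \<Rightarrow> real \<Rightarrow>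
   (nat \<Rightarrow> nat \<Rightarrow> real \<Rightarrow> real) \<Rightarrow> (nat \<Rightarrow> real \<Rightarrow> real) \<Rightarrow> (real^'n \<Rightarrow> real) \<Rightarrow> bool" where
  "avcbf_with f g U m \<epsilon> A \<alpha> b \<longleftrightarrow>
     relative_degree f g m b \<and>
     (\<forall>i\<in>{1..m}. hocbf_with \<epsilon> (m+1-i) (A i)) \<and>
     (\<forall>j\<in>{1..m}. class_kappa (\<alpha> j) \<and> times_differentiable (m - j) (\<alpha> j)) \<and>
     (\<forall>z\<in>(\<Inter>i<m. C_set f g m b \<alpha> i). (\<forall>i\<in>{1..m}. snd z i 1 > 0) \<longrightarrow>
        (SUP (u, \<nu>)\<in>U \<times> U_a m \<epsilon> A (snd z). ereal (psi f g m b \<alpha> m z u \<nu>)) \<ge> 0)"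

text \<open>
  (x, P) is a trajectory on [0, \<infinity>) under the inputs u and \<nu>, given as functions of time. A feedback
  controller is covered by evaluating it along its closed-loop trajectory.
\<close>

definition trajectory ::
  "(real^'n \<Rightarrow> real^'n) \<Rightarrow> (real^'n \<Rightarrow> real^'q^'n) \<Rightarrow> nat \<Rightarrow> (real \<Rightarrow> real^'q) \<Rightarrow> (real \<Rightarrow> nat \<Rightarrow> real) \<Rightarrow>
   (real \<Rightarrow> real^'n) \<Rightarrow> (real \<Rightarrow> nat \<Rightarrow> nat \<Rightarrow> real) \<Rightarrow> bool" where
  "trajectory f g m u \<nu> x P \<longleftrightarrow>
     (\<forall>t\<ge>0. (x has_vector_derivative f (x t) + g (x t) *v u t) (at t within {0..})) \<and>
     (\<forall>t\<ge>0. \<forall>i\<in>{1..m}. \<forall>j\<in>{1..m+1-i}.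
        ((\<lambda>s. P s i j) has_real_derivative chain (m+1-i) (P t i) (\<nu> t i) j) (at t within {0..}))"

end

theory Submission
  imports Defs
begin

text \<open>
  If a real function \<open>y\<close> of time satisfies \<open>y' + \<alpha> y \<ge> 0\<close> with \<open>\<alpha>\<close> of class kappa, it cannot
  decrease while it is negative; hence it stays nonnegative if it starts there. (A comparison
  theorem would require \<open>\<alpha>\<close> to be Lipschitz.) Since the auxiliary variables are positive,
  nonnegativity of
  \<open>\<psi>\<^sub>i\<close> is of this form for \<open>y = \<psi>\<^sub>i\<^sub>-\<^sub>1\<close>, and it descends from \<open>\<psi>\<^sub>m\<^sub>-\<^sub>1\<close> to \<open>\<psi>\<^sub>0 = a\<^sub>1 b\<close>.

  The analytic content is that the directional derivatives in the definition of \<open>\<psi>\<^sub>i\<close>, taken with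
  zero input, are the derivatives along the actual trajectory. This follows from a chain rule along
  all curves tangent to the vector field: both the straight lines of the definition and the
  trajectory are such curves.
\<close>

section \<open>Scalar functions that cannot decrease while negative\<close>

lemma nonneg_of_deriv_nonneg_when_neg:
  fixes y y' :: "real \<Rightarrow> real"
  assumes der: "\<And>t. t \<ge> 0 \<Longrightarrow> (y has_real_derivative y' t) (at t within {0..})"
    and "y 0 \<ge> 0"
    and neg: "\<And>t. t \<ge> 0 \<Longrightarrow> y t < 0 \<Longrightarrow> y' t \<ge> 0"
    and "t \<ge> 0"
  shows "y t \<ge> 0"
proof (rule ccontr)
  assume t: "\<not> y t \<ge> 0"
  \<comment> \<open>The maximum of this compact set is the last time up to \<open>t\<close> at which
    \<open>y\<close> is nonnegative. The mean value theorem is applied after it, where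
    \<open>y\<close> is negative.\<close>
  let ?S = "{0..t} \<inter> y -` {0..}"
  have "continuous_on {0..} y"
    unfolding continuous_on_eq_continuous_within by (blast intro: DERIV_continuous der[simplified])
  then have cont: "continuous_on {0..t} y"
    by (rule continuous_on_subset) auto
  have "closed ?S"
    by (rule continuous_closed_preimage[OF cont]) auto
  then have "compact ?S"
    by (simp add: compact_eq_bounded_closed bounded_Int)
  moreover have "?S \<noteq> {}"
    using assms by auto
  ultimately obtain s where s: "s \<in> ?S" and s_max: "\<And>w. w \<in> ?S \<Longrightarrow> w \<le> s"
    using compact_attains_sup by metis
  have "s < t"
    using s t by (cases "s = t") auto
  \<comment> \<open>Times after \<open>s\<close> are positive, hence interior to the half-line, so
    the derivative within \<open>{0..}\<close> is the two-sided one that the mean value theorem asks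
    for.\<close>
  have der_at: "(y has_real_derivative y' w) (at w)" if "s < w" for w
    using der[of w] that s at_within_interior[of w "{0..}"] by auto
  obtain w where w: "s < w" "w < t" "y t - y s = (t - s) * y' w"
  proof -
    have "continuous_on {s..t} y"
      using cont s by (auto intro: continuous_on_subset)
    then show thesis
      using MVT[OF \<open>s < t\<close>, of y] der_at that
      by (metis DERIV_unique real_differentiable_def)
  qed
  have "y w < 0"
    using s_max[of w] w s by force
  then have "y' w \<ge> 0"
    using neg[of w] w s by auto
  then have "y t \<ge> y s"
    using w by (metis diff_ge_0_iff_ge less_eq_real_def mult_nonneg_nonneg order.strict_trans)
  then show False
    using s t by auto
qed

section \<open>Repeated differentiation along curves tangent to the dynamics\<close>

lemma times_differentiable_Suc:
  "times_differentiable (Suc r) h \<longleftrightarrow>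
     (\<forall>y. h differentiable (at y)) \<and> times_differentiable r (deriv h)"
proof -
  have "(deriv ^^ Suc l) h = (deriv ^^ l) (deriv h)" for l
    by (simp add: funpow_swap1)
  then show ?thesis
    unfolding times_differentiable_def by (simp add: All_less_Suc2 del: funpow.simps)
qed

lemma times_differentiable_mono:
  "times_differentiable r h \<Longrightarrow> l \<le> r \<Longrightarrow> times_differentiable l h"
  by (auto simp: times_differentiable_def)

text \<open>Tangency concerns a single time \<open>t\<close>, and the time set \<open>S\<close> is
  free, so that a full line through a point and a trajectory on the half-line both qualify.\<close>

definition tangent ::
  "(real^'n \<Rightarrow> real^'n) \<Rightarrow> (real^'n \<Rightarrow> real^'q^'n) \<Rightarrow> nat \<Rightarrow> real set \<Rightarrow> real \<Rightarrow>
   (real \<Rightarrow> real^'n) \<Rightarrow> (real \<Rightarrow> nat \<Rightarrow> nat \<Rightarrow> real) \<Rightarrow> bool" where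
  "tangent f g m S t X Q \<longleftrightarrow>
     (\<exists>u. (X has_vector_derivative f (X t) + g (X t) *v u) (at t within S)) \<and>
     (\<exists>\<nu>. \<forall>i\<in>{1..m}. \<forall>j\<in>{1..m+1-i}.
        ((\<lambda>s. Q s i j) has_real_derivative chain (m+1-i) (Q t i) (\<nu> i) j) (at t within S))"

text \<open>
  The inputs are existentially quantified in the tangency condition, so the derivative \<open>h'\<close>
  cannot depend on them.
\<close>

definition deriv_along ::
  "(real^'n \<Rightarrow> real^'n) \<Rightarrow> (real^'n \<Rightarrow> real^'q^'n) \<Rightarrow> nat \<Rightarrow>
   ('n state \<Rightarrow> real) \<Rightarrow> ('n state \<Rightarrow> real) \<Rightarrow> bool" where
  "deriv_along f g m h h' \<longleftrightarrow>
     (\<forall>S t X Q. tangent f g m S t X Q \<longrightarrow>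
        ((\<lambda>s. h (X s, Q s)) has_real_derivative h' (X t, Q t)) (at t within S))"

text \<open>\<open>r\<close> is a budget: the number of successive derivatives that exist and are
  again functions of the state alone. With budget 0 the next derivative may involve the
  inputs.\<close>

primrec diff_along ::
  "(real^'n \<Rightarrow> real^'n) \<Rightarrow> (real^'n \<Rightarrow> real^'q^'n) \<Rightarrow> nat \<Rightarrow> nat \<Rightarrow> ('n state \<Rightarrow> real) \<Rightarrow> bool" where
  "diff_along f g m 0 h = True"
| "diff_along f g m (Suc r) h = (\<exists>h'. deriv_along f g m h h' \<and> diff_along f g m r h')"

lemma deriv_alongD:
  "deriv_along f g m h h' \<Longrightarrow> tangent f g m S t X Q \<Longrightarrow>
     ((\<lambda>s. h (X s, Q s)) has_real_derivative h' (X t, Q t)) (at t within S)"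
  by (simp add: deriv_along_def)

text \<open>The straight line in \<open>time_deriv\<close> is tangent at time 0, with
  \<open>u\<close> and \<open>\<nu>\<close> as the witnessing inputs.\<close>

lemma time_deriv_eq:
  assumes "deriv_along f g m h h'"
  shows "time_deriv f g m h z u \<nu> = h' z"
proof -
  obtain x P where z: "z = (x, P)"
    by fastforce
  let ?X = "\<lambda>s. x + s *\<^sub>R (f x + g x *v u)"
  let ?Q = "\<lambda>s i j. P i j + s * chain (m+1-i) (P i) (\<nu> i) j"
  have "((\<lambda>s. h (?X s, ?Q s)) has_real_derivative h' (?X 0, ?Q 0)) (at 0 within UNIV)"
  proof (rule deriv_alongD[OF assms])
    have "(?X has_vector_derivative f (?X 0) + g (?X 0) *v u) (at 0 within UNIV)"
      by (auto intro!: derivative_eq_intros)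
    moreover have "((\<lambda>s. ?Q s i j) has_real_derivative chain (m+1-i) (?Q 0 i) (\<nu> i) j)
        (at 0 within UNIV)" for i j
      by (auto intro!: derivative_eq_intros)
    ultimately show "tangent f g m UNIV 0 ?X ?Q"
      unfolding tangent_def by blast
  qed
  then show ?thesis
    by (simp add: z time_deriv_def DERIV_imp_deriv)
qed

lemma diff_along_mono:
  "diff_along f g m r h \<Longrightarrow> l \<le> r \<Longrightarrow> diff_along f g m l h"
proof (induction r arbitrary: h l)
  case (Suc r)
  then show ?case
    by (cases l) auto
qed simp

lemma diff_along_add:
  "diff_along f g m r h \<Longrightarrow> diff_along f g m r k \<Longrightarrow> diff_along f g m r (\<lambda>z. h z + k z)"
proof (induction r arbitrary: h k)
  case (Suc r)
  then obtain h' k' where d: "deriv_along f g m h h'" "deriv_along f g m k k'"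
    and r: "diff_along f g m r h'" "diff_along f g m r k'"
    by auto
  have "deriv_along f g m (\<lambda>z. h z + k z) (\<lambda>z. h' z + k' z)"
    using d unfolding deriv_along_def by (auto intro!: DERIV_add)
  then show ?case
    using Suc.IH[OF r] by auto
qed simp

lemma diff_along_mult:
  "diff_along f g m r h \<Longrightarrow> diff_along f g m r k \<Longrightarrow> diff_along f g m r (\<lambda>z. h z * k z)"
proof (induction r arbitrary: h k)
  case (Suc r)
  then obtain h' k' where d: "deriv_along f g m h h'" "deriv_along f g m k k'"
    and r: "diff_along f g m r h'" "diff_along f g m r k'"
    by auto
  \<comment> \<open>Each term of the product rule keeps one factor undifferentiated, so the factors
    themselves are also needed with budget \<open>r\<close>.\<close>
  have hk: "diff_along f g m r h" "diff_along f g m r k"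
    using Suc.prems diff_along_mono by (metis le_SucI order_refl)+
  have "deriv_along f g m (\<lambda>z. h z * k z) (\<lambda>z. h' z * k z + k' z * h z)"
    using d unfolding deriv_along_def by (auto intro!: DERIV_mult)
  moreover have "diff_along f g m r (\<lambda>z. h' z * k z + k' z * h z)"
    using Suc.IH r hk diff_along_add by blast
  ultimately show ?case
    by auto
qed simp

text \<open>The chain rule turns \<open>\<alpha>\<close> into \<open>deriv \<alpha>\<close>, hence
  the generalization over \<open>\<alpha>\<close>. It is applied pointwise, so the top derivative of
  \<open>\<alpha>\<close> need not be continuous.\<close>

lemma diff_along_compose:
  "times_differentiable r \<alpha> \<Longrightarrow> diff_along f g m r h \<Longrightarrow> diff_along f g m r (\<lambda>z. \<alpha> (h z))"
proof (induction r arbitrary: \<alpha> h)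
  case (Suc r)
  then obtain h' where d: "deriv_along f g m h h'" and r: "diff_along f g m r h'"
    by auto
  have \<alpha>: "\<And>y. (\<alpha> has_real_derivative deriv \<alpha> y) (at y)" "times_differentiable r (deriv \<alpha>)"
    using Suc.prems(1) by (auto simp: times_differentiable_Suc DERIV_deriv_iff_real_differentiable)
  have "deriv_along f g m (\<lambda>z. \<alpha> (h z)) (\<lambda>z. deriv \<alpha> (h z) * h' z)"
    using d unfolding deriv_along_def by (auto intro!: DERIV_chain2[OF \<alpha>(1)])
  moreover have "diff_along f g m r h"
    using Suc.prems(2) diff_along_mono by (metis le_SucI order_refl)
  then have "diff_along f g m r (\<lambda>z. deriv \<alpha> (h z) * h' z)"
    using Suc.IH \<alpha>(2) r diff_along_mult by blast
  ultimately show ?case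
    by auto
qed simp

section \<open>Budgets of the auxiliary variables, of \<open>b\<close> and of the
  \<open>\<psi>\<^sub>i\<close>\<close>

lemma diff_along_aux:
  "i \<in> {1..m} \<Longrightarrow> 1 \<le> j \<Longrightarrow> j + r \<le> m + 1 - i \<Longrightarrow> diff_along f g m r (\<lambda>z. snd z i j)"
proof (induction r arbitrary: j)
  case (Suc r)
  have "deriv_along f g m (\<lambda>z. snd z i j) (\<lambda>z. snd z i (Suc j))"
    unfolding deriv_along_def
  proof (intro allI impI)
    fix S t and X :: "real \<Rightarrow> real^'a" and Q
    assume "tangent f g m S t X Q"
    then obtain \<nu> where "\<forall>i\<in>{1..m}. \<forall>j\<in>{1..m+1-i}.
      ((\<lambda>s. Q s i j) has_real_derivative chain (m+1-i) (Q t i) (\<nu> i) j) (at t within S)"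
      unfolding tangent_def by blast
    then have "((\<lambda>s. Q s i j) has_real_derivative chain (m+1-i) (Q t i) (\<nu> i) j) (at t within S)"
      using Suc.prems by auto
    \<comment> \<open>A budget of at least one forces \<open>j\<close> below the chain length, so
      \<open>chain\<close> gives the next entry and not the input.\<close>
    then show "((\<lambda>s. snd (X s, Q s) i j) has_real_derivative snd (X t, Q t) i (Suc j)) (at t within S)"
      using Suc.prems by (simp add: chain_def)
  qed
  moreover have "diff_along f g m r (\<lambda>z. snd z i (Suc j))"
    using Suc by simp
  ultimately show ?case
    by auto
qed simp

text \<open>\<open>g y *v u\<close> combines the columns of \<open>g y\<close> with the components
  of \<open>u\<close> as coefficients, so by linearity the input contributes only Lie derivatives
  along columns.\<close>

lemma frechet_derivative_input:
  fixes g :: "real^'n \<Rightarrow> real^'q^'n"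
  assumes "h differentiable (at y)"
    and "\<And>j. lie (\<lambda>y. column j (g y)) h y = 0"
  shows "frechet_derivative h (at y) (f y + g y *v u) = lie f h y"
proof -
  interpret linear "frechet_derivative h (at y)"
    using assms(1) by (rule linear_frechet_derivative)
  show ?thesis
    using assms(2) by (simp add: add sum scale lie_def matrix_mult_sum scalar_mult_eq_scaleR)
qed

lemma diff_along_lie:
  assumes "relative_degree f g m b"
  shows "k + r < m \<Longrightarrow> diff_along f g m r (\<lambda>z. (lie f ^^ k) b (fst z))"
proof (induction r arbitrary: k)
  case (Suc r)
  let ?h = "(lie f ^^ k) b"
  have d: "?h differentiable (at y)" for y
    using assms Suc.prems by (auto simp: relative_degree_def)
  \<comment> \<open>\<open>k + Suc r < m\<close> gives \<open>k < m - 1\<close>, the range in which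
    the relative degree excludes the input.\<close>
  have 0: "lie (\<lambda>y. column j (g y)) ?h y = 0" for j y
    using assms Suc.prems by (auto simp: relative_degree_def)
  have "deriv_along f g m (\<lambda>z. ?h (fst z)) (\<lambda>z. lie f ?h (fst z))"
    unfolding deriv_along_def
  proof (intro allI impI)
    fix S t X Q
    assume "tangent f g m S t X Q"
    then obtain u where "(X has_vector_derivative f (X t) + g (X t) *v u) (at t within S)"
      unfolding tangent_def by blast
    moreover have "(?h has_derivative frechet_derivative ?h (at (X t))) (at (X t))"
      using d frechet_derivative_works by blast
    ultimately have "((?h \<circ> X) has_vector_derivative
        frechet_derivative ?h (at (X t)) (f (X t) + g (X t) *v u)) (at t within S)"
      by (intro vector_derivative_diff_chain_within) (auto intro: has_derivative_at_withinI)
    then show "((\<lambda>s. ?h (fst (X s, Q s))) has_real_derivative lie f ?h (fst (X t, Q t)))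
        (at t within S)"
      by (simp add: frechet_derivative_input[OF d 0] o_def has_real_derivative_iff_has_vector_derivative)
  qed
  moreover have "diff_along f g m r (\<lambda>z. lie f ?h (fst z))"
    using Suc.IH[of "Suc k"] Suc.prems by simp
  ultimately show ?case
    by auto
qed simp

text \<open>Each passage from \<open>\<psi>\<^sub>i\<close> to
  \<open>\<psi>\<^sub>i\<^sub>+\<^sub>1\<close> spends one derivative, starting from the
  \<open>m - 1\<close> that \<open>a\<^sub>1\<close> and \<open>b\<close> allow.\<close>

lemma diff_along_psi:
  assumes b: "relative_degree f g m b"
    and \<alpha>: "\<And>j. j \<in> {1..m} \<Longrightarrow> times_differentiable (m - j) (\<alpha> j)"
  shows "i < m \<Longrightarrow> diff_along f g m (m - 1 - i) (\<lambda>z. psi f g m b \<alpha> i z 0 (\<lambda>_. 0))"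
proof (induction i)
  case 0
  then have "diff_along f g m (m - 1) (\<lambda>z. snd z 1 1)"
    by (intro diff_along_aux) auto
  moreover have "diff_along f g m (m - 1) (\<lambda>z. b (fst z))"
    using diff_along_lie[OF b, of 0 "m - 1"] 0 by simp
  ultimately show ?case
    using diff_along_mult by fastforce
next
  case (Suc i)
  let ?\<Psi> = "\<lambda>z. psi f g m b \<alpha> i z 0 (\<lambda>_. 0)"
  let ?r = "m - 1 - Suc i"
  have \<Psi>: "diff_along f g m (Suc ?r) ?\<Psi>"
    using Suc by (simp add: Suc_diff_Suc)
  then obtain h' where h': "deriv_along f g m ?\<Psi> h'" "diff_along f g m ?r h'"
    by auto
  have "times_differentiable ?r (\<alpha> (Suc i))"
    using \<alpha>[of "Suc i"] Suc.prems by (auto intro: times_differentiable_mono)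
  moreover have "diff_along f g m ?r ?\<Psi>"
    using diff_along_mono[OF \<Psi>] by simp
  ultimately have "diff_along f g m ?r (\<lambda>z. \<alpha> (Suc i) (?\<Psi> z))"
    by (rule diff_along_compose)
  \<comment> \<open>The chain with index \<open>i + 2\<close> has length \<open>m - 1 - i\<close>,
    so \<open>diff_along_aux\<close> grants its first entry exactly \<open>?r\<close>
    derivatives.\<close>
  moreover have "diff_along f g m ?r (\<lambda>z. snd z (Suc (Suc i)) 1)"
    using Suc.prems by (intro diff_along_aux) auto
  ultimately have "diff_along f g m ?r (\<lambda>z. snd z (Suc (Suc i)) 1 * (h' z + \<alpha> (Suc i) (?\<Psi> z)))"
    by (intro diff_along_mult diff_along_add h')
  then show ?case
    using Suc.prems by (simp add: time_deriv_eq[OF h'(1)])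
qed

section \<open>Descent along the trajectory\<close>

theorem theorem2:
  fixes f :: "real^'n \<Rightarrow> real^'n"
    and g :: "real^'n \<Rightarrow> real^'q^'n"
    and u_min u_max :: "real^'q"
    and b :: "real^'n \<Rightarrow> real"
    and m :: nat
    and \<epsilon> :: real
    and A :: "nat \<Rightarrow> nat \<Rightarrow> real \<Rightarrow> real"
    and \<alpha> :: "nat \<Rightarrow> real \<Rightarrow> real"
    and u :: "real \<Rightarrow> real^'q"
    and \<nu> :: "real \<Rightarrow> nat \<Rightarrow> real"
    and x :: "real \<Rightarrow> real^'n"
    and P :: "real \<Rightarrow> nat \<Rightarrow> nat \<Rightarrow> real"
  assumes "loc_lipschitz UNIV f" and "loc_lipschitz UNIV g"
    and "\<epsilon> > 0"
    and "avcbf_with f g (cbox u_min u_max) m \<epsilon> A \<alpha> b"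
    and "trajectory f g m u \<nu> x P"
    and "\<forall>t\<ge>0. \<forall>i\<in>{1..m}. P t i 1 > 0"
    and "(x 0, P 0) \<in> (\<Inter>i<m. C_set f g m b \<alpha> i)"
    and "loc_lipschitz {0..} u" and "\<forall>i\<in>{1..m}. loc_lipschitz {0..} (\<lambda>t. \<nu> t i)"
    and "\<forall>t\<ge>0. u t \<in> cbox u_min u_max"
    and "\<forall>t\<ge>0. \<nu> t \<in> U_a m \<epsilon> A (P t)"
    and "\<forall>t\<ge>0. psi f g m b \<alpha> m (x t, P t) (u t) (\<nu> t) \<ge> 0"
    and "\<forall>t\<ge>0. (x t, P t) \<in> C_set f g m b \<alpha> (m - 1)"
  shows "(\<forall>t\<ge>0. (x t, P t) \<in> (\<Inter>i<m. C_set f g m b \<alpha> i)) \<and> (\<forall>t\<ge>0. b (x t) \<ge> 0)"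
proof -
  let ?\<Psi> = "\<lambda>i z. psi f g m b \<alpha> i z 0 (\<lambda>_. 0)"
  have b: "relative_degree f g m b"
    and \<alpha>: "\<And>j. j \<in> {1..m} \<Longrightarrow> class_kappa (\<alpha> j)"
    and \<alpha>d: "\<And>j. j \<in> {1..m} \<Longrightarrow> times_differentiable (m - j) (\<alpha> j)"
    using assms(4) by (auto simp: avcbf_with_def)
  have m: "1 \<le> m"
    using b by (simp add: relative_degree_def)
  have descend: "\<forall>t\<ge>0. ?\<Psi> i (x t, P t) \<ge> 0"
    if i: "Suc i < m" and IH: "\<forall>t\<ge>0. ?\<Psi> (Suc i) (x t, P t) \<ge> 0" for i
  proof (intro allI impI)
    \<comment> \<open>As \<open>i \<le> m - 2\<close>, the budget is at least one. The resulting
      \<open>h'\<close> serves both in the definition of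
      \<open>\<psi>\<^sub>i\<^sub>+\<^sub>1\<close> and along the trajectory.\<close>
    have "diff_along f g m (Suc (m - 1 - Suc i)) (?\<Psi> i)"
      using diff_along_psi[OF b \<alpha>d, of i] i by (simp add: Suc_diff_Suc)
    then obtain h' where h': "deriv_along f g m (?\<Psi> i) h'"
      by auto
    have der: "((\<lambda>t. ?\<Psi> i (x t, P t)) has_real_derivative h' (x t, P t)) (at t within {0..})"
      if "t \<ge> 0" for t
    proof (rule deriv_alongD[OF h'])
      show "tangent f g m {0..} t x P"
        using assms(5) that unfolding trajectory_def tangent_def by blast
    qed
    have nn: "h' (x t, P t) \<ge> 0" if "t \<ge> 0" and neg: "?\<Psi> i (x t, P t) < 0" for t
    proof -
      \<comment> \<open>This is the factor in front of
        \<open>\<psi>\<^sub>i\<^sub>+\<^sub>1\<close>, present because \<open>Suc i < m\<close>;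
        being positive, it can be cancelled.\<close>
      have "P t (Suc (Suc i)) 1 > 0"
        using assms(6) i \<open>t \<ge> 0\<close> by auto
      moreover have "P t (Suc (Suc i)) 1 * (h' (x t, P t) + \<alpha> (Suc i) (?\<Psi> i (x t, P t))) \<ge> 0"
        using IH i \<open>t \<ge> 0\<close> by (simp add: time_deriv_eq[OF h'])
      ultimately have "h' (x t, P t) + \<alpha> (Suc i) (?\<Psi> i (x t, P t)) \<ge> 0"
        by (simp add: zero_le_mult_iff)
      moreover have "strict_mono (\<alpha> (Suc i))" "\<alpha> (Suc i) 0 = 0"
        using \<alpha>[of "Suc i"] i by (simp_all add: class_kappa_def)
      then have "\<alpha> (Suc i) (?\<Psi> i (x t, P t)) < 0"
        using strict_monoD neg by metis
      ultimately show ?thesis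
        by linarith
    qed
    have init: "?\<Psi> i (x 0, P 0) \<ge> 0"
      using assms(7) i by (auto simp: C_set_def)
    show "?\<Psi> i (x t, P t) \<ge> 0" if "t \<ge> 0" for t
      by (rule nonneg_of_deriv_nonneg_when_neg[OF der init nn that])
  qed
  have \<Psi>: "\<forall>t\<ge>0. ?\<Psi> i (x t, P t) \<ge> 0" if "i \<le> m - 1" for i
    using that
  proof (induction i rule: inc_induct)
    case base
    then show ?case
      using assms(13) by (simp add: C_set_def)
  next
    case (step i)
    show ?case
      by (rule descend[OF _ step.IH]) (use step.hyps in auto)
  qed
  have "b (x t) \<ge> 0" if "t \<ge> 0" for t
  proof -
    have "P t 1 1 > 0"
      using assms(6) m that by auto
    then show ?thesis
      using \<Psi>[of 0] that zero_le_mult_iff[of "P t 1 1" "b (x t)"] by auto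
  qed
  then show ?thesis
    using \<Psi> by (auto simp: C_set_def)
qed

end
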